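(* For the optimal stopping problem $\sup_{\tau \in \mathcal{T}} \mathbb{E}\, g(\tau, X_\tau)$, any depth $I \ge 2$ and any constant $\varepsilon > 0$, there exist positive integers $q_1, \dots, q_{I-1}$ and a vector $\Theta = (\theta_0, \theta_1, \dots, \theta_{N-1}) \in \mathbb{R}^{Nq}$ such that the corresponding stopping time $$\tau^{\Theta} = \sum_{n=1}^{N} n f^{\theta_n}(X_n) \prod_{j=0}^{n-1} (1-f^{\theta_j}(X_j)),$$ where $\theta_N \in \mathbb{R}^q$ is chosen such that $f^{\theta_N} \equiv 1$, satisfies $$\mathbb{E}\, g(\tau^{\Theta}, X_{\tau^{\Theta}}) \ge \sup_{\tau \in \mathcal{T}} \mathbb{E}\, g(\tau, X_\tau) - \varepsilon.$$
   Context: Let $N$ and $d$ be positive integers and let $X = (X_n)_{n=0}^N$ be an $\mathbb{R}^d$-valued discrete-time Markov process on a probability space $(\Omega, \mathcal{F}, \mathbb{P})$. Let $\mathcal{F}_n$ be the $\sigma$-algebra generated by $X_0, X_1, \dots, X_n$. An $X$-stopping time is a random variable $\tau \colon \Omega \to \{0,1,\dots,N\}$ such that $\{\tau = n\} \in \mathcal{F}_n$ for all $n \in \{0,1,\dots,N\}$; $\mathcal{T}$ denotes the set of all $X$-stopping times. Let $g \colon \{0,1,\dots,N\} \times \mathbb{R}^d \to \mathbb{R}$ be a measurable function satisfying $\mathbb{E}\,|g(n,X_n)| < \infty$ for all $n \in \{0,1,\dots,N\}$. Neural networks: given an integer depth $I \ge 2$ and positive integers $q_1, \dots, q_{I-1}$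 (numbers of nodes in the hidden layers), let $$q = 1 + q_1 + \dots + q_{I-1} + d q_1 + q_1 q_2 + \dots + q_{I-2} q_{I-1} + q_{I-1}.$$ A parameter $\theta \in \mathbb{R}^q$ consists of the entries of matrices $A_1 \in \mathbb{R}^{q_1 \times d}$, $A_i \in \mathbb{R}^{q_i \times q_{i-1}}$ for $2 \le i \le I-1$, $A_I \in \mathbb{R}^{1 \times q_{I-1}}$ and vectors $b_i \in \mathbb{R}^{q_i}$ for $1 \le i \le I-1$, $b_I \in \mathbb{R}$. Set $a_i^{\theta}(x) = A_i x + b_i$ for $i = 1, \dots, I$. For $j \in \mathbb{N}$, let $\varphi_j \colon \mathbb{R}^j \to \mathbb{R}^j$, $\varphi_j(x_1,\dots,x_j) = (x_1^+, \dots, x_j^+)$, be the component-wise ReLU function, where $x^+ = \max\{x,0\}$. Define $f^{\theta} \colon \mathbb{R}^d \to \{0,1\}$ by $$f^{\theta} = 1_{[0,\infty)} \circ a_I^{\theta} \circ \varphi_{q_{I-1}} \circ a_{I-1}^{\theta} \circ \dots \circ \varphi_{q_1} \circ a_1^{\theta},$$ where $1_{[0,\infty)} \colon \mathbb{R} \to \{0,1\}$ is the indicator function of $[0,\infty)$. *)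

theory Defs
  imports "HOL-Probability.Probability" "Jordan_Normal_Form.Matrix"
begin

unbundle no vec_syntax

section \<open>Processes and stopping times\<close>

definition generated_sigma :: "'a measure \<Rightarrow> (nat \<Rightarrow> 'a \<Rightarrow> 'b::topological_space) \<Rightarrow> nat \<Rightarrow> 'a measure" where
  "generated_sigma M X n =
     sigma (space M) {X i -` B \<inter> space M | i B. i \<le> n \<and> B \<in> sets borel}"

definition cond_prob_given :: "'a measure \<Rightarrow> 'a measure \<Rightarrow> 'a set \<Rightarrow> 'a \<Rightarrow> real" where
  "cond_prob_given M G A = real_cond_exp M G (indicator A)"

text \<open>Only \<open>X 0, \<dots>, X N\<close> are part of the process; values of \<open>X\<close> at later indices are
  irrelevant junk, here and below.\<close>

definition markov_process :: "'a measure \<Rightarrow> (nat \<Rightarrow> 'a \<Rightarrow> 'b::topological_space) \<Rightarrow> nat \<Rightarrow> bool" where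
  "markov_process M X N \<longleftrightarrow>
     (\<forall>n\<le>N. X n \<in> borel_measurable M) \<and>
     (\<forall>n<N. \<forall>B\<in>sets borel. AE \<omega> in M.
        cond_prob_given M (generated_sigma M X n) (X (Suc n) -` B \<inter> space M) \<omega> =
        cond_prob_given M (vimage_algebra (space M) (X n) borel) (X (Suc n) -` B \<inter> space M) \<omega>)"

definition stopping_times :: "'a measure \<Rightarrow> (nat \<Rightarrow> 'a \<Rightarrow> 'b::topological_space) \<Rightarrow> nat \<Rightarrow> ('a \<Rightarrow> nat) set" where
  "stopping_times M X N =
     {\<tau>. (\<forall>\<omega>\<in>space M. \<tau> \<omega> \<le> N) \<and>
          (\<forall>n\<le>N. {\<omega>\<in>space M. \<tau> \<omega> = n} \<in> sets (generated_sigma M X n))}"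

definition expected_reward ::
  "'a measure \<Rightarrow> (nat \<Rightarrow> 'a \<Rightarrow> 'b) \<Rightarrow> (nat \<Rightarrow> 'b \<Rightarrow> real) \<Rightarrow> ('a \<Rightarrow> nat) \<Rightarrow> real" where
  "expected_reward M X g \<tau> = (\<integral>\<omega>. g (\<tau> \<omega>) (X (\<tau> \<omega>) \<omega>) \<partial>M)"

section \<open>Feedforward networks with a parameter vector\<close>

text \<open>\<open>d\<close> is the input dimension, \<open>I\<close> the depth and \<open>q 1, \<dots>, q (I - 1)\<close> are the
  numbers of nodes in the hidden layers.\<close>

definition num_params :: "nat \<Rightarrow> nat \<Rightarrow> (nat \<Rightarrow> nat) \<Rightarrow> nat" where
  "num_params d I q =
     1 + (\<Sum>i=1..I-1. q i) + d * q 1 + (\<Sum>i=1..I-2. q i * q (Suc i)) + q (I - 1)"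

definition layer_width :: "nat \<Rightarrow> nat \<Rightarrow> (nat \<Rightarrow> nat) \<Rightarrow> nat \<Rightarrow> nat" where
  "layer_width d I q i = (if i = 0 then d else if i = I then 1 else q i)"

text \<open>The parameter vector lists the layers \<open>1, \<dots>, I\<close> one after the other; each layer
  contributes the entries of its weight matrix, row by row, followed by its bias vector.\<close>

definition layer_offset :: "nat \<Rightarrow> nat \<Rightarrow> (nat \<Rightarrow> nat) \<Rightarrow> nat \<Rightarrow> nat" where
  "layer_offset d I q i =
     (\<Sum>k=1..<i. layer_width d I q k * layer_width d I q (k - 1) + layer_width d I q k)"

definition weight_matrix :: "nat \<Rightarrow> nat \<Rightarrow> (nat \<Rightarrow> nat) \<Rightarrow> real vec \<Rightarrow> nat \<Rightarrow> real mat" where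
  "weight_matrix d I q \<theta> i =
     mat (layer_width d I q i) (layer_width d I q (i - 1))
       (\<lambda>(r, c). \<theta> $ (layer_offset d I q i + r * layer_width d I q (i - 1) + c))"

definition bias_vector :: "nat \<Rightarrow> nat \<Rightarrow> (nat \<Rightarrow> nat) \<Rightarrow> real vec \<Rightarrow> nat \<Rightarrow> real vec" where
  "bias_vector d I q \<theta> i =
     vec (layer_width d I q i)
       (\<lambda>r. \<theta> $ (layer_offset d I q i + layer_width d I q i * layer_width d I q (i - 1) + r))"

lemma layer_offset_total:
  assumes "I \<ge> 2"
  shows "layer_offset d I q (Suc I) = num_params d I q"
proof -
  obtain m where I: "I = Suc (Suc m)"
    using assms by (metis add_2_eq_Suc le_Suc_ex)
  let ?w = "layer_width d I q"
  have step: "(\<Sum>k=1..<Suc (Suc j). ?w k * ?w (k - 1) + ?w k)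
      = (\<Sum>i=1..Suc j. q i) + d * q 1 + (\<Sum>i=1..j. q i * q (Suc i))" if "j \<le> m" for j
    using that
  proof (induction j)
    case 0
    then show ?case by (simp add: layer_width_def I)
  next
    case (Suc j)
    then show ?case by (simp add: layer_width_def I)
  qed
  show ?thesis
    using step[of m] by (simp add: layer_offset_def num_params_def layer_width_def I)
qed

definition affine_layer :: "nat \<Rightarrow> nat \<Rightarrow> (nat \<Rightarrow> nat) \<Rightarrow> real vec \<Rightarrow> nat \<Rightarrow> real vec \<Rightarrow> real vec" where
  "affine_layer d I q \<theta> i x = weight_matrix d I q \<theta> i *\<^sub>v x + bias_vector d I q \<theta> i"

definition relu :: "real vec \<Rightarrow> real vec" where
  "relu = map_vec (\<lambda>t. max t 0)"

fun hidden_layers :: "nat \<Rightarrow> nat \<Rightarrow> (nat \<Rightarrow> nat) \<Rightarrow> real vec \<Rightarrow> nat \<Rightarrow> real vec \<Rightarrow> real vec" where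
  "hidden_layers d I q \<theta> 0 x = x"
| "hidden_layers d I q \<theta> (Suc i) x = relu (affine_layer d I q \<theta> (Suc i) (hidden_layers d I q \<theta> i x))"

text \<open>Network inputs live in \<open>real ^ 'd\<close>, whose coordinates are indexed by a finite type;
  \<open>from_nat_into UNIV\<close> restricts to a bijection from \<open>{..<CARD('d)}\<close> to that type.\<close>

definition coords :: "real ^ 'd \<Rightarrow> real vec" where
  "coords x = vec CARD('d) (\<lambda>i. vec_nth x (from_nat_into UNIV i))"

definition network :: "nat \<Rightarrow> (nat \<Rightarrow> nat) \<Rightarrow> real vec \<Rightarrow> real ^ 'd \<Rightarrow> nat" where
  "network I q \<theta> x =
     indicator {0..}
       (affine_layer CARD('d) I q \<theta> I (hidden_layers CARD('d) I q \<theta> (I - 1) (coords x)) $ 0)"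

text \<open>Subtraction is on \<open>nat\<close>, but does not truncate: \<open>network\<close> only takes the values 0 and 1.\<close>

definition network_stopping_time ::
  "nat \<Rightarrow> (nat \<Rightarrow> 'a \<Rightarrow> real ^ 'd) \<Rightarrow> nat \<Rightarrow> (nat \<Rightarrow> nat) \<Rightarrow> (nat \<Rightarrow> real vec) \<Rightarrow> 'a \<Rightarrow> nat" where
  "network_stopping_time N X I q \<theta> \<omega> =
     (\<Sum>n=1..N. n * network I q (\<theta> n) (X n \<omega>) * (\<Prod>j=0..<n. 1 - network I q (\<theta> j) (X j \<omega>)))"

end

theory Submission
  imports Defs
begin

text \<open>
  Let \<open>Y\<^sub>N = g(N, X\<^sub>N)\<close> and \<open>Y\<^sub>n = max (g(n, X\<^sub>n)) (E[Y\<^sub>n\<^sub>+\<^sub>1 | X\<^sub>n])\<close>. By the Markov property conditioning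
  on \<open>X\<^sub>n\<close> agrees with conditioning on the whole past, so \<open>E Y\<^sub>0\<close> bounds every reward, and it is
  attained by stopping as soon as \<open>X\<^sub>n\<close> lies in the Borel set \<open>D\<^sub>n\<close> where the reward is at least the
  continuation value. A Borel set is, up to small measure, of the form \<open>{h \<ge> 0}\<close> for a ReLU network \<open>h\<close>
  with one hidden layer: choose compact sets inside \<open>D\<^sub>n\<close> and its complement and approximate the continuous function
  with values \<open>1\<close> and \<open>-1\<close> on them. Uniform density of such networks follows from Stone-Weierstrass, applied
  to linear combinations of the functions \<open>exp (a \<bullet> x)\<close>, and piecewise linear interpolation of \<open>exp\<close>.
\<close>

section \<open>Networks with one hidden layer\<close>

text \<open>Zero outer weights are allowed, so \<open>m\<close> only bounds the number of hidden
  units. The domain is any real inner product space, so that interpolants on the line and networks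
  on \<open>real ^ 'd\<close> fall under one notion.\<close>

definition shallow_net :: "nat \<Rightarrow> ('b::real_inner \<Rightarrow> real) \<Rightarrow> bool" where
  "shallow_net m h \<longleftrightarrow>
     (\<exists>c a b b0. h = (\<lambda>x. (\<Sum>k<m. c k * max (inner (a k) x + b k) 0) + b0))"

lemma shallow_net_const: "shallow_net m (\<lambda>x. b0)"
  unfolding shallow_net_def by (rule exI[of _ "\<lambda>_. 0"]) auto

lemma shallow_net_unit: "shallow_net 1 (\<lambda>x. c * max (inner a x + b) 0)"
  unfolding shallow_net_def
  by (rule exI[of _ "\<lambda>_. c"], rule exI[of _ "\<lambda>_. a"], rule exI[of _ "\<lambda>_. b"], rule exI[of _ 0]) simp

text \<open>The two hidden layers are placed side by side: units with index below \<open>m\<close>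
  come from \<open>f\<close>, the others from \<open>h\<close>, and the output biases are
  added.\<close>

lemma shallow_net_add:
  assumes "shallow_net m f" and "shallow_net n h"
  shows "shallow_net (m + n) (\<lambda>x. f x + h x)"
proof -
  obtain c a b b0 where f: "f = (\<lambda>x. (\<Sum>k<m. c k * max (inner (a k) x + b k) 0) + b0)"
    using assms(1) unfolding shallow_net_def by blast
  obtain c' a' b' b0' where h: "h = (\<lambda>x. (\<Sum>k<n. c' k * max (inner (a' k) x + b' k) 0) + b0')"
    using assms(2) unfolding shallow_net_def by blast
  have split: "(\<Sum>k<m + n. u k) = (\<Sum>k<m. u k) + (\<Sum>k<n. u (m + k))" for u :: "nat \<Rightarrow> real"
    by (induction n) auto
  \<comment> \<open>\<open>join\<close> and \<open>joina\<close> are the same concatenation at two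
    types, as a local definition is monomorphic.\<close>
  define join where "join u v = (\<lambda>k. if k < m then u k else v (k - m))"
    for u v :: "nat \<Rightarrow> real"
  define joina where "joina u v = (\<lambda>k. if k < m then u k else v (k - m))"
    for u v :: "nat \<Rightarrow> 'a"
  have "(\<lambda>x. f x + h x) = (\<lambda>x. (\<Sum>k<m + n. join c c' k *
      max (inner (joina a a' k) x + join b b' k) 0) + (b0 + b0'))"
    unfolding f h split by (simp add: join_def joina_def add_ac)
  then show ?thesis
    unfolding shallow_net_def by blast
qed

text \<open>Padding by a zero network of width \<open>m' - m\<close>.\<close>

lemma shallow_net_mono:
  assumes "shallow_net m h" and "m \<le> m'"
  shows "shallow_net m' h"
  using shallow_net_add[OF assms(1) shallow_net_const[of "m' - m" 0]] assms(2) by simp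

text \<open>An inner weight \<open>\<alpha> k\<close> on the line becomes the vector
  \<open>\<alpha> k *\<^sub>R a\<close>, so no further units are needed.\<close>

lemma shallow_net_ridge:
  assumes "shallow_net m L"
  shows "shallow_net m (\<lambda>x. L (inner a x))"
proof -
  obtain c \<alpha> b b0 where L: "L = (\<lambda>x. (\<Sum>k<m. c k * max (inner (\<alpha> k) x + b k) 0) + b0)"
    using assms unfolding shallow_net_def by blast
  show ?thesis
    unfolding shallow_net_def L
    by (rule exI[of _ c], rule exI[of _ "\<lambda>k. \<alpha> k *\<^sub>R a"], rule exI[of _ b], rule exI[of _ b0]) simp
qed

lemma shallow_net_continuous: "shallow_net m h \<Longrightarrow> continuous_on UNIV h"
  unfolding shallow_net_def by (auto intro!: continuous_intros)

section \<open>Piecewise linear interpolation on the line\<close>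

text \<open>Induction from knot to knot. Keeping \<open>L\<close> constant to the right of the last
  knot strengthens the claim so that the next segment needs only two further hinges, which leave the
  part already built unchanged.\<close>

lemma shallow_net_interpolates:
  fixes f :: "real \<Rightarrow> real"
  assumes "0 < d"
    and osc: "\<And>s s'. s \<in> {t..t + real n * d} \<Longrightarrow> s' \<in> {t..t + real n * d} \<Longrightarrow> \<bar>s - s'\<bar> \<le> d \<Longrightarrow>
      \<bar>f s - f s'\<bar> \<le> e"
  shows "\<exists>m L. shallow_net m L \<and> (\<forall>s\<ge>t + real n * d. L s = f (t + real n * d)) \<and>
    (\<forall>s\<in>{t..t + real n * d}. \<bar>f s - L s\<bar> \<le> e)"
  using osc
proof (induction n)
  case 0
  show ?case
    \<comment> \<open>The hypothesis at \<open>s = s' = t\<close> supplies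
      \<open>0 \<le> e\<close>.\<close>
    using 0[of t t] \<open>0 < d\<close> by (intro exI[of _ 0] exI[of _ "\<lambda>_. f t"]) (auto intro: shallow_net_const)
next
  case (Suc n)
  define u where "u = t + real n * d"
  define v where "v = u + d"
  have v: "t + real (Suc n) * d = v"
    by (simp add: u_def v_def algebra_simps)
  have tu: "t \<le> u" "u \<le> v"
    using \<open>0 < d\<close> by (auto simp: u_def v_def)
  note osc = Suc.prems[unfolded v]
  have "\<exists>m L. shallow_net m L \<and> (\<forall>s\<ge>u. L s = f u) \<and> (\<forall>s\<in>{t..u}. \<bar>f s - L s\<bar> \<le> e)"
    unfolding u_def by (rule Suc.IH) (rule osc; use tu in \<open>auto simp: u_def\<close>)
  then obtain m L where L: "shallow_net m L" "\<forall>s\<ge>u. L s = f u" "\<forall>s\<in>{t..u}. \<bar>f s - L s\<bar> \<le> e"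
    by blast
  \<comment> \<open>The slope between the knots \<open>u\<close> and \<open>v\<close>: in
    \<open>L'\<close> one hinge switches it on at \<open>u\<close>, and a second one switches it off
    at \<open>v\<close>.\<close>
  define r where "r = (f v - f u) / d"
  define L' where "L' s = L s + (r * max (inner 1 s + (- u)) 0 + (- r) * max (inner 1 s + (- v)) 0)" for s
  have "shallow_net (m + (1 + 1)) L'"
    unfolding L'_def by (intro shallow_net_add shallow_net_unit L)
  moreover have "\<forall>s\<ge>v. L' s = f v"
  proof safe
    fix s assume "s \<ge> v"
    then have "L' s = f u + r * d"
      using L(2) tu by (simp add: L'_def v_def algebra_simps)
    then show "L' s = f v"
      using \<open>0 < d\<close> by (simp add: r_def)
  qed
  moreover have "\<forall>s\<in>{t..v}. \<bar>f s - L' s\<bar> \<le> e"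
  proof
    fix s assume s: "s \<in> {t..v}"
    show "\<bar>f s - L' s\<bar> \<le> e"
    proof (cases "s \<le> u")
      case True
      then show ?thesis
        using L(3) s tu by (auto simp: L'_def)
    next
      case False
      define w where "w = (s - u) / d"
      have w: "0 \<le> w" "w \<le> 1"
        using False s \<open>0 < d\<close> by (auto simp: w_def v_def)
      have "L' s = f u + (f v - f u) * w"
        using False s tu L(2) by (simp add: L'_def r_def w_def)
      \<comment> \<open>The error is a convex combination of the differences to the two knot values,
        and both knots are within \<open>d\<close> of \<open>s\<close>.\<close>
      then have "f s - L' s = (1 - w) * (f s - f u) + w * (f s - f v)"
        by (simp add: algebra_simps)
      also have "\<bar>\<dots>\<bar> \<le> (1 - w) * \<bar>f s - f u\<bar> + w * \<bar>f s - f v\<bar>"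
        using w by (intro order_trans[OF abs_triangle_ineq]) (simp add: abs_mult)
      also have "\<dots> \<le> (1 - w) * e + w * e"
        using w False s tu
        by (intro add_mono mult_left_mono osc) (auto simp: v_def)
      finally show ?thesis
        by (simp add: algebra_simps)
    qed
  qed
  ultimately show ?case
    unfolding v by blast
qed

text \<open>Interpolate at knots closer than the modulus of uniform continuity for
  \<open>e / 2\<close>; halving \<open>e\<close> makes the final bound strict.\<close>

lemma shallow_net_dense_real:
  fixes f :: "real \<Rightarrow> real"
  assumes "continuous_on {a..b} f" and "0 < e"
  shows "\<exists>m L. shallow_net m L \<and> (\<forall>s\<in>{a..b}. \<bar>f s - L s\<bar> < e)"
proof (cases "a < b")
  case True
  have "uniformly_continuous_on {a..b} f"
    using assms(1) by (rule compact_uniformly_continuous) simp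
  then obtain d where d: "0 < d"
    "\<And>s s'. s \<in> {a..b} \<Longrightarrow> s' \<in> {a..b} \<Longrightarrow> dist s' s < d \<Longrightarrow> dist (f s') (f s) < e / 2"
    using \<open>0 < e\<close> unfolding uniformly_continuous_on_def by (metis half_gt_zero)
  obtain n where n: "(b - a) / d < real n"
    using reals_Archimedean2 by blast
  have "0 < real n"
    using True d n by (smt (verit) divide_pos_pos)
  define \<delta> where "\<delta> = (b - a) / real n"
  have \<delta>: "0 < \<delta>" "\<delta> < d" "a + real n * \<delta> = b"
    using True n d \<open>0 < real n\<close> by (auto simp: \<delta>_def field_simps)
  have "\<exists>m L. shallow_net m L \<and> (\<forall>s\<ge>a + real n * \<delta>. L s = f (a + real n * \<delta>)) \<and>
    (\<forall>s\<in>{a..a + real n * \<delta>}. \<bar>f s - L s\<bar> \<le> e / 2)"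
  proof (rule shallow_net_interpolates[OF \<delta>(1)])
    fix s s' assume "s \<in> {a..a + real n * \<delta>}" "s' \<in> {a..a + real n * \<delta>}" "\<bar>s - s'\<bar> \<le> \<delta>"
    then show "\<bar>f s - f s'\<bar> \<le> e / 2"
      using d(2)[of s' s] \<delta> by (auto simp: dist_real_def)
  qed
  then obtain m L where "shallow_net m L" "\<forall>s\<in>{a..b}. \<bar>f s - L s\<bar> \<le> e / 2"
    unfolding \<delta>(3) by blast
  then show ?thesis
    using \<open>0 < e\<close> by (intro exI[of _ m] exI[of _ L]) (auto intro: le_less_trans)
next
  case False
  then have "{a..b} \<subseteq> {a}"
    by auto
  then show ?thesis
    using \<open>0 < e\<close> by (intro exI[of _ 0] exI[of _ "\<lambda>_. f a"]) (auto intro: shallow_net_const)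
qed

section \<open>Exponential sums and density on compact sets\<close>

text \<open>ReLU networks are not closed under products, so Stone-Weierstrass is applied to this
  class instead: a product of exponentials of linear forms is again such an exponential. Constants
  are the case \<open>a = 0\<close>.\<close>

inductive exp_sum :: "('b::euclidean_space \<Rightarrow> real) \<Rightarrow> bool" where
  exp: "exp_sum (\<lambda>x. c * exp (inner a x))"
| add: "exp_sum f \<Longrightarrow> exp_sum h \<Longrightarrow> exp_sum (\<lambda>x. f x + h x)"

lemma exp_sum_mult_exp:
  assumes "exp_sum h"
  shows "exp_sum (\<lambda>x. c * exp (inner a x) * h x)"
  using assms
proof induction
  case (exp c' a')
  have "(\<lambda>x. c * exp (inner a x) * (c' * exp (inner a' x))) = (\<lambda>x. (c * c') * exp (inner (a + a') x))"
    by (auto simp: inner_add_left exp_add)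
  then show ?case
    by (metis exp_sum.exp)
qed (simp add: distrib_left exp_sum.add)

lemma exp_sum_mult:
  assumes "exp_sum f" and "exp_sum h"
  shows "exp_sum (\<lambda>x. f x * h x)"
  using assms
  by induction (simp_all add: exp_sum_mult_exp distrib_right exp_sum.add)

lemma exp_sum_dense:
  fixes f :: "'b::euclidean_space \<Rightarrow> real"
  assumes "compact K" and "continuous_on K f" and "0 < e"
  shows "\<exists>h. exp_sum h \<and> (\<forall>x\<in>K. \<bar>f x - h x\<bar> < e)"
proof (rule Stone_Weierstrass_HOL[OF assms(1)])
  show "exp_sum (\<lambda>x::'b. c)" for c
    using exp_sum.exp[of c 0] by simp
  show "continuous_on K h" if "exp_sum h" for h
    using that by induction (auto intro!: continuous_intros)
  show "\<exists>f. exp_sum f \<and> f x \<noteq> f y" if "x \<in> K \<and> y \<in> K \<and> x \<noteq> y" for x y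
  proof -
    \<comment> \<open>The direction \<open>x - y\<close> separates the points, since its inner
      product with itself is nonzero, and \<open>exp\<close> is injective.\<close>
    have "inner (x - y) x \<noteq> inner (x - y) y"
      using that by (metis eq_iff_diff_eq_0 inner_diff_right inner_eq_zero_iff)
    then show ?thesis
      by (intro exI[of _ "\<lambda>z. 1 * exp (inner (x - y) z)"] conjI exp_sum.exp) auto
  qed
qed (use assms in \<open>auto intro: exp_sum.add exp_sum_mult\<close>)

text \<open>On \<open>K\<close> the form \<open>inner a x\<close> takes values in a bounded
  interval, so each exponential reduces to a function of one real variable. For a sum the error is
  split in halves.\<close>

lemma shallow_net_approximates_exp_sum:
  assumes "exp_sum f" and "compact K" and "0 < e"
  shows "\<exists>m h. shallow_net m h \<and> (\<forall>x\<in>K. \<bar>f x - h x\<bar> < e)"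
  using assms(1,3)
proof (induction arbitrary: e)
  case (exp c a)
  have "compact ((\<lambda>x. inner a x) ` K)"
    using assms(2) by (intro compact_continuous_image) (auto intro!: continuous_intros)
  then obtain u v where uv: "(\<lambda>x. inner a x) ` K \<subseteq> {u..v}"
    by (metis compact_imp_bounded bounded_subset_cbox_symmetric cbox_interval)
  have "continuous_on {u..v} (\<lambda>s. c * exp s)"
    by (intro continuous_intros)
  then obtain m L where L: "shallow_net m L" "\<forall>s\<in>{u..v}. \<bar>c * exp s - L s\<bar> < e"
    using shallow_net_dense_real[OF _ exp] by blast
  then show ?case
    using uv shallow_net_ridge[OF L(1), of a] by (intro exI[of _ m] exI[of _ "\<lambda>x. L (inner a x)"]) auto
next
  case (add f1 f2)
  obtain m1 h1 where 1: "shallow_net m1 h1" "\<forall>x\<in>K. \<bar>f1 x - h1 x\<bar> < e / 2"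
    using add.IH(1)[of "e / 2"] add.prems by auto
  obtain m2 h2 where 2: "shallow_net m2 h2" "\<forall>x\<in>K. \<bar>f2 x - h2 x\<bar> < e / 2"
    using add.IH(2)[of "e / 2"] add.prems by auto
  have "\<forall>x\<in>K. \<bar>f1 x + f2 x - (h1 x + h2 x)\<bar> < e"
  proof
    fix x assume "x \<in> K"
    then show "\<bar>f1 x + f2 x - (h1 x + h2 x)\<bar> < e"
      using 1(2)[rule_format, of x] 2(2)[rule_format, of x] by linarith
  qed
  then show ?case
    using shallow_net_add[OF 1(1) 2(1)] by blast
qed

lemma shallow_net_dense:
  fixes f :: "'b::euclidean_space \<Rightarrow> real"
  assumes "compact K" and "continuous_on K f" and "0 < e"
  shows "\<exists>m h. shallow_net m h \<and> (\<forall>x\<in>K. \<bar>f x - h x\<bar> < e)"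
proof -
  obtain p where p: "exp_sum p" "\<forall>x\<in>K. \<bar>f x - p x\<bar> < e / 2"
    using exp_sum_dense[OF assms(1,2), of "e / 2"] assms(3) by auto
  obtain m h where h: "shallow_net m h" "\<forall>x\<in>K. \<bar>p x - h x\<bar> < e / 2"
    using shallow_net_approximates_exp_sum[OF p(1) assms(1), of "e / 2"] assms(3) by auto
  have "\<forall>x\<in>K. \<bar>f x - h x\<bar> < e"
  proof
    fix x assume "x \<in> K"
    then show "\<bar>f x - h x\<bar> < e"
      using p(2)[rule_format, of x] h(2)[rule_format, of x] by linarith
  qed
  then show ?thesis
    using h(1) by blast
qed

section \<open>Approximation of Borel sets\<close>

lemma inner_regular_compact:
  fixes \<nu> :: "'b::euclidean_space measure"
  assumes "finite_measure \<nu>" and "sets \<nu> = sets borel" and "D \<in> sets borel" and "0 < e"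
  shows "\<exists>K\<subseteq>D. compact K \<and> measure \<nu> (D - K) < e"
proof -
  interpret finite_measure \<nu> by fact
  let ?\<K> = "{K. K \<subseteq> D \<and> compact K}"
  have D: "D \<in> sets \<nu>"
    using assms by simp
  have *: "emeasure \<nu> D = (SUP K\<in>?\<K>. emeasure \<nu> K)"
    by (rule inner_regular) (use assms in auto)
  show ?thesis
  proof (cases "measure \<nu> D < e")
    case True
    then show ?thesis
      by (intro exI[of _ "{}"]) auto
  next
    case False
    \<comment> \<open>In this case \<open>measure \<nu> D - e\<close> is nonnegative, so it passes
      to \<open>ennreal\<close> without truncation.\<close>
    then have "ennreal (measure \<nu> D - e) < emeasure \<nu> D"
      using assms(4) by (simp add: emeasure_eq_measure ennreal_less_iff)
    then obtain K where K: "K \<subseteq> D" "compact K" "ennreal (measure \<nu> D - e) < emeasure \<nu> K"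
      unfolding * less_SUP_iff by blast
    have "K \<in> sets \<nu>"
      using assms(2) K(2) by (simp add: borel_compact)
    moreover have "measure \<nu> D - e < measure \<nu> K"
      using K(3) False by (simp add: emeasure_eq_measure ennreal_less_iff)
    ultimately show ?thesis
      using finite_measure_Diff[OF D _ K(1)] K by (intro exI[of _ K]) auto
  qed
qed

text \<open>An error below \<open>1\<close> preserves the signs of the target values
  \<open>1\<close> and \<open>- 1\<close>. Misclassified points therefore lie outside both compact
  sets, each of which misses mass less than \<open>e / 2\<close> of \<open>D\<close> or its
  complement.\<close>

lemma shallow_net_approximates_set:
  fixes \<nu> :: "'b::euclidean_space measure"
  assumes \<nu>: "finite_measure \<nu>" "sets \<nu> = sets borel" and D: "D \<in> sets borel" and "0 < e"
  shows "\<exists>m h. shallow_net m h \<and> measure \<nu> {x. (x \<in> D) \<noteq> (0 \<le> h x)} < e"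
proof -
  interpret finite_measure \<nu> by fact
  obtain K1 where K1: "K1 \<subseteq> D" "compact K1" "measure \<nu> (D - K1) < e / 2"
    using inner_regular_compact[OF \<nu> D, of "e / 2"] \<open>0 < e\<close> by auto
  obtain K2 where K2: "K2 \<subseteq> - D" "compact K2" "measure \<nu> (- D - K2) < e / 2"
    using inner_regular_compact[OF \<nu>, of "- D" "e / 2"] D \<open>0 < e\<close> by auto
  \<comment> \<open>The two compact sets are closed and disjoint, so this piecewise constant
    function is continuous on their union.\<close>
  have "continuous_on (K1 \<union> K2) (\<lambda>x. if x \<in> K1 then 1 else - 1 :: real)"
    using K1 K2 by (intro continuous_on_cases) (auto intro: compact_imp_closed)
  from shallow_net_dense[OF compact_Un[OF K1(2) K2(2)] this, of 1]
  obtain m h where h: "shallow_net m h"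
      "\<forall>x\<in>K1 \<union> K2. \<bar>(if x \<in> K1 then 1 else - 1) - h x\<bar> < 1"
    by (metis less_numeral_extra(1))
  have "0 \<le> h x" if "x \<in> K1" for x
    using h(2)[rule_format, of x] that by auto
  moreover have "h x < 0" if "x \<in> K2" for x
  proof -
    have "x \<notin> K1" using that K1 K2 by auto
    then show ?thesis using h(2)[rule_format, of x] that by auto
  qed
  ultimately have sub: "{x. (x \<in> D) \<noteq> (0 \<le> h x)} \<subseteq> (D - K1) \<union> (- D - K2)"
    by force
  have S: "D - K1 \<in> sets \<nu>" "- D - K2 \<in> sets \<nu>"
    using \<nu> D K1 K2 by (auto simp: borel_compact)
  have "measure \<nu> {x. (x \<in> D) \<noteq> (0 \<le> h x)} \<le> measure \<nu> ((D - K1) \<union> (- D - K2))"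
    using S by (intro finite_measure_mono[OF sub]) auto
  also have "\<dots> \<le> measure \<nu> (D - K1) + measure \<nu> (- D - K2)"
    by (rule measure_Un_le[OF S])
  finally show ?thesis
    using h(1) K1 K2 by (intro exI[of _ m] exI[of _ h]) auto
qed

section \<open>Realization by networks of arbitrary depth\<close>

lemma layer_offset_Suc:
  "1 \<le> i \<Longrightarrow> layer_offset d I q (Suc i) =
     layer_offset d I q i + layer_width d I q i * layer_width d I q (i - 1) + layer_width d I q i"
  by (simp add: layer_offset_def)

lemma layer_offset_mono: "i \<le> j \<Longrightarrow> layer_offset d I q i \<le> layer_offset d I q j"
  unfolding layer_offset_def by (intro sum_mono2) auto

lemma row_major_index_less:
  fixes r c m n :: nat
  assumes "r < m" and "c < n"
  shows "r * n + c < m * n"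
proof -
  have "r * n + c < Suc r * n"
    using assms(2) by simp
  also have "\<dots> \<le> m * n"
    using assms(1) by (intro mult_le_mono1) simp
  finally show ?thesis .
qed

text \<open>The layers occupy consecutive disjoint blocks of the flat parameter vector, so their
  entries can be prescribed independently. The blocks are filled one after the other, and
  \<open>layer_offset_total\<close> shows that all of them fit.\<close>

lemma parameters_exist:
  fixes W :: "nat \<Rightarrow> nat \<Rightarrow> nat \<Rightarrow> real" and \<beta> :: "nat \<Rightarrow> nat \<Rightarrow> real"
  assumes "I \<ge> 2"
  shows "\<exists>\<theta>\<in>carrier_vec (num_params d I q). \<forall>i\<in>{1..I}.
    weight_matrix d I q \<theta> i =
      mat (layer_width d I q i) (layer_width d I q (i - 1)) (\<lambda>(r, c). W i r c) \<and>
    bias_vector d I q \<theta> i = vec (layer_width d I q i) (\<beta> i)"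
proof -
  let ?w = "layer_width d I q" and ?o = "layer_offset d I q"
  have "\<exists>f. \<forall>i\<in>{1..n}. (\<forall>r<?w i. \<forall>c<?w (i - 1). f (?o i + r * ?w (i - 1) + c) = W i r c) \<and>
      (\<forall>r<?w i. f (?o i + ?w i * ?w (i - 1) + r) = \<beta> i r)" for n
  proof (induction n)
    case 0
    show ?case by simp
  next
    case (Suc n)
    then obtain f where f: "\<And>i r c. 1 \<le> i \<Longrightarrow> i \<le> n \<Longrightarrow> r < ?w i \<Longrightarrow> c < ?w (i - 1) \<Longrightarrow>
        f (?o i + r * ?w (i - 1) + c) = W i r c"
      "\<And>i r. 1 \<le> i \<Longrightarrow> i \<le> n \<Longrightarrow> r < ?w i \<Longrightarrow> f (?o i + ?w i * ?w (i - 1) + r) = \<beta> i r"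
      by (metis atLeastAtMost_iff)
    let ?O = "?o (Suc n)" and ?k = "?w (Suc n) * ?w n"
    \<comment> \<open>Earlier blocks are kept. In the new block, quotient and remainder by the row
      length \<open>?w n\<close> recover row and column, and the biases follow the matrix.\<close>
    define f' where "f' j = (if j < ?O then f j
      else if j - ?O < ?k then W (Suc n) ((j - ?O) div ?w n) ((j - ?O) mod ?w n)
      else \<beta> (Suc n) (j - ?O - ?k))" for j
    have before: "?o i + ?w i * ?w (i - 1) + ?w i \<le> ?O" if "1 \<le> i" "i \<le> n" for i
      using layer_offset_mono[of "Suc i" "Suc n" d I q] that by (simp add: layer_offset_Suc)
    have "(\<forall>r<?w i. \<forall>c<?w (i - 1). f' (?o i + r * ?w (i - 1) + c) = W i r c) \<and>
      (\<forall>r<?w i. f' (?o i + ?w i * ?w (i - 1) + r) = \<beta> i r)" if i: "i \<in> {1..Suc n}" for i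
    proof (cases "i = Suc n")
      case True
      then show ?thesis
        using row_major_index_less[of _ "?w (Suc n)" _ "?w n"]
        by (auto simp: f'_def add.assoc)
    next
      case False
      then have "1 \<le> i" "i \<le> n"
        using i by auto
      then have "?o i + r * ?w (i - 1) + c < ?O" if "r < ?w i" "c < ?w (i - 1)" for r c
        using row_major_index_less[OF that] before[of i] by linarith
      moreover have "?o i + ?w i * ?w (i - 1) + r < ?O" if "r < ?w i" for r
        using that before[of i] \<open>1 \<le> i\<close> \<open>i \<le> n\<close> by linarith
      ultimately show ?thesis
        using f \<open>1 \<le> i\<close> \<open>i \<le> n\<close> by (simp add: f'_def)
    qed
    then show ?case
      by (intro exI[of _ f']) blast
  qed
  then obtain f where f: "\<And>i r c. 1 \<le> i \<Longrightarrow> i \<le> I \<Longrightarrow> r < ?w i \<Longrightarrow> c < ?w (i - 1) \<Longrightarrow>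
        f (?o i + r * ?w (i - 1) + c) = W i r c"
      "\<And>i r. 1 \<le> i \<Longrightarrow> i \<le> I \<Longrightarrow> r < ?w i \<Longrightarrow> f (?o i + ?w i * ?w (i - 1) + r) = \<beta> i r"
    by (metis atLeastAtMost_iff)
  let ?\<theta> = "vec (num_params d I q) f"
  have bound: "?o i + ?w i * ?w (i - 1) + ?w i \<le> num_params d I q" if "1 \<le> i" "i \<le> I" for i
    using layer_offset_mono[of "Suc i" "Suc I" d I q] that layer_offset_total[OF assms, of d q]
    by (simp add: layer_offset_Suc)
  have "weight_matrix d I q ?\<theta> i = mat (?w i) (?w (i - 1)) (\<lambda>(r, c). W i r c) \<and>
      bias_vector d I q ?\<theta> i = vec (?w i) (\<beta> i)" if i: "1 \<le> i" "i \<le> I" for i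
  proof
    show "weight_matrix d I q ?\<theta> i = mat (?w i) (?w (i - 1)) (\<lambda>(r, c). W i r c)"
    proof (rule eq_matI)
      fix r c assume "r < dim_row (mat (?w i) (?w (i - 1)) (\<lambda>(r, c). W i r c))"
        "c < dim_col (mat (?w i) (?w (i - 1)) (\<lambda>(r, c). W i r c))"
      then have rc: "r < ?w i" "c < ?w (i - 1)"
        by auto
      then have "?o i + r * ?w (i - 1) + c < num_params d I q"
        using row_major_index_less[OF rc] bound[OF i] by linarith
      then show "weight_matrix d I q ?\<theta> i $$ (r, c) = mat (?w i) (?w (i - 1)) (\<lambda>(r, c). W i r c) $$ (r, c)"
        using rc f(1)[OF i rc] by (simp add: weight_matrix_def)
    qed (auto simp: weight_matrix_def)
    show "bias_vector d I q ?\<theta> i = vec (?w i) (\<beta> i)"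
      using f(2)[OF i] bound[OF i] by (intro eq_vecI) (auto simp: bias_vector_def)
  qed
  then show ?thesis
    by (intro bexI[of _ ?\<theta>]) auto
qed

lemma affine_layer_index:
  assumes "weight_matrix d I q \<theta> i =
      mat (layer_width d I q i) (layer_width d I q (i - 1)) (\<lambda>(r, c). W r c)"
    and "bias_vector d I q \<theta> i = vec (layer_width d I q i) \<beta>"
    and "dim_vec x = layer_width d I q (i - 1)" and "r < layer_width d I q i"
  shows "affine_layer d I q \<theta> i x $ r = (\<Sum>c<layer_width d I q (i - 1). W r c * x $ c) + \<beta> r"
  using assms by (simp add: affine_layer_def scalar_prod_def atLeast0LessThan)

lemma inner_eq_sum_coords:
  fixes a x :: "real ^ 'd"
  shows "inner a x = (\<Sum>c<CARD('d). vec_nth a (from_nat_into UNIV c) * coords x $ c)"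
proof -
  have "inner a x = (\<Sum>i\<in>UNIV. vec_nth a i * vec_nth x i)"
    by (simp add: inner_vec_def)
  also have "\<dots> = (\<Sum>c<CARD('d). vec_nth a (from_nat_into UNIV c) * vec_nth x (from_nat_into UNIV c))"
    by (rule sum.reindex_bij_betw[symmetric, OF bij_betw_from_nat_into_finite]) simp
  finally show ?thesis
    by (simp add: coords_def)
qed

lemma network_realizes_shallow_net:
  fixes h :: "real ^ 'd \<Rightarrow> real"
  assumes "shallow_net m h" and "I \<ge> 2"
  shows "\<exists>\<theta>\<in>carrier_vec (num_params CARD('d) I (\<lambda>_. m)).
    \<forall>x. network I (\<lambda>_. m) \<theta> x = (if 0 \<le> h x then 1 else 0)"
proof -
  obtain c a b b0 where h: "h = (\<lambda>x. (\<Sum>k<m. c k * max (inner (a k) x + b k) 0) + b0)"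
    using assms(1) unfolding shallow_net_def by blast
  \<comment> \<open>Layer \<open>1\<close> computes the ridge functions, layers \<open>2, \<dots>, I - 1\<close> are the identity, which ReLU
    preserves on the nonnegative outputs of layer \<open>1\<close>, and layer \<open>I\<close> takes the linear combination.\<close>
  define W where "W i r s = (if i = 1 then vec_nth (a r) (from_nat_into UNIV s)
    else if i = I then c s else if r = s then 1 else 0)" for i r s
  define \<beta> where "\<beta> i r = (if i = 1 then b r else if i = I then b0 else 0)" for i r :: nat
  let ?d = "CARD('d)" and ?q = "\<lambda>_. m"
  obtain \<theta> where \<theta>: "\<theta> \<in> carrier_vec (num_params ?d I ?q)"
    "\<And>i. i \<in> {1..I} \<Longrightarrow> weight_matrix ?d I ?q \<theta> i =
      mat (layer_width ?d I ?q i) (layer_width ?d I ?q (i - 1)) (\<lambda>(r, s). W i r s)"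
    "\<And>i. i \<in> {1..I} \<Longrightarrow> bias_vector ?d I ?q \<theta> i = vec (layer_width ?d I ?q i) (\<beta> i)"
    using parameters_exist[OF assms(2), of ?d ?q W \<beta>] by blast
  \<comment> \<open>All hidden layers carry the same vector of unit outputs. The induction starts at
    layer \<open>1\<close>, hence the shift by \<open>Suc\<close>.\<close>
  have hidden: "dim_vec (hidden_layers ?d I ?q \<theta> (Suc i) (coords x)) = m \<and>
      (\<forall>k<m. hidden_layers ?d I ?q \<theta> (Suc i) (coords x) $ k = max (inner (a k) x + b k) 0)"
    if "Suc i < I" for i and x :: "real ^ 'd"
    using that
  proof (induction i)
    case 0
    have "affine_layer ?d I ?q \<theta> 1 (coords x) $ k = inner (a k) x + b k" if "k < m" for k
      using affine_layer_index[OF \<theta>(2,3)[of 1], of "coords x" k] that 0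
      by (simp add: layer_width_def coords_def W_def \<beta>_def inner_eq_sum_coords)
    moreover have "dim_vec (affine_layer ?d I ?q \<theta> 1 (coords x)) = m"
      using \<theta>(2,3)[of 1] 0 by (simp add: affine_layer_def layer_width_def)
    ultimately show ?case
      by (simp add: relu_def)
  next
    case (Suc i)
    let ?y = "hidden_layers ?d I ?q \<theta> (Suc i) (coords x)"
    have y: "dim_vec ?y = m" "\<And>k. k < m \<Longrightarrow> ?y $ k = max (inner (a k) x + b k) 0"
      using Suc by auto
    \<comment> \<open>Layer \<open>Suc (Suc i)\<close> is neither \<open>1\<close> nor
      \<open>I\<close>, so its weights form the identity matrix and its bias is zero.\<close>
    have "affine_layer ?d I ?q \<theta> (Suc (Suc i)) ?y $ k = ?y $ k" if "k < m" for k
      using affine_layer_index[OF \<theta>(2,3)[of "Suc (Suc i)"], of ?y k] that Suc.prems y(1)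
      by (simp add: layer_width_def W_def \<beta>_def if_distrib[of "\<lambda>t. t * _"] cong: if_cong del: hidden_layers.simps)
    moreover have "dim_vec (affine_layer ?d I ?q \<theta> (Suc (Suc i)) ?y) = m"
      using \<theta>(2,3)[of "Suc (Suc i)"] Suc.prems by (simp add: affine_layer_def layer_width_def)
    ultimately show ?case
      using y by (subst (1 2) hidden_layers.simps(2)) (simp add: relu_def del: hidden_layers.simps)
  qed
  have "affine_layer ?d I ?q \<theta> I (hidden_layers ?d I ?q \<theta> (I - 1) (coords x)) $ 0 = h x" for x :: "real ^ 'd"
  proof -
    obtain i where i: "I = Suc (Suc i)"
      using assms(2) by (metis add_2_eq_Suc le_Suc_ex)
    let ?y = "hidden_layers ?d I ?q \<theta> (Suc i) (coords x)"
    have y: "dim_vec ?y = m" "\<And>k. k < m \<Longrightarrow> ?y $ k = max (inner (a k) x + b k) 0"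
      using hidden[of i x] i by auto
    have "affine_layer ?d I ?q \<theta> I ?y $ 0 = (\<Sum>k<m. c k * ?y $ k) + b0"
      using affine_layer_index[OF \<theta>(2,3)[of I], of ?y 0] y(1) i
      by (simp add: layer_width_def W_def \<beta>_def del: hidden_layers.simps)
    also have "\<dots> = h x"
      using y(2) by (simp add: h del: hidden_layers.simps)
    finally show ?thesis
      using i by simp
  qed
  then have "\<forall>x. network I ?q \<theta> x = (if 0 \<le> h x then 1 else 0)"
    by (simp add: network_def indicator_def)
  then show ?thesis
    using \<theta>(1) by blast
qed

section \<open>First entry times\<close>

text \<open>The alternative \<open>n = N\<close> makes the minimum exist and forces stopping at the
  horizon.\<close>

definition first_entry :: "(nat \<Rightarrow> 'a \<Rightarrow> 'b) \<Rightarrow> nat \<Rightarrow> (nat \<Rightarrow> 'b set) \<Rightarrow> 'a \<Rightarrow> nat" where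
  "first_entry X N D \<omega> = (LEAST n. n = N \<or> X n \<omega> \<in> D n)"

lemma first_entry_le: "first_entry X N D \<omega> \<le> N"
  unfolding first_entry_def by (rule Least_le) simp

lemma first_entry_eq_iff:
  assumes "n \<le> N"
  shows "first_entry X N D \<omega> = n \<longleftrightarrow> (n = N \<or> X n \<omega> \<in> D n) \<and> (\<forall>j<n. X j \<omega> \<notin> D j)"
proof
  assume *: "first_entry X N D \<omega> = n"
  have "n = N \<or> X n \<omega> \<in> D n"
    unfolding *[symmetric] first_entry_def by (rule LeastI[of _ N]) simp
  moreover have "X j \<omega> \<notin> D j" if "j < n" for j
    using not_less_Least[of j "\<lambda>n. n = N \<or> X n \<omega> \<in> D n"] that *
    by (auto simp: first_entry_def)
  ultimately show "(n = N \<or> X n \<omega> \<in> D n) \<and> (\<forall>j<n. X j \<omega> \<notin> D j)"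
    by blast
next
  assume *: "(n = N \<or> X n \<omega> \<in> D n) \<and> (\<forall>j<n. X j \<omega> \<notin> D j)"
  show "first_entry X N D \<omega> = n"
    unfolding first_entry_def
    by (rule Least_equality) (use * assms in \<open>auto simp: not_le[symmetric]\<close>)
qed

lemma first_entry_cong:
  assumes "\<And>n. n < N \<Longrightarrow> X n \<omega> \<in> D n \<longleftrightarrow> X n \<omega> \<in> D' n"
  shows "first_entry X N D \<omega> = first_entry X N D' \<omega>"
proof -
  define n where "n = first_entry X N D' \<omega>"
  have n: "n \<le> N"
    unfolding n_def by (rule first_entry_le)
  have "(n = N \<or> X n \<omega> \<in> D' n) \<and> (\<forall>j<n. X j \<omega> \<notin> D' j)"
    using first_entry_eq_iff[OF n] n_def by metis
  then have "(n = N \<or> X n \<omega> \<in> D n) \<and> (\<forall>j<n. X j \<omega> \<notin> D j)"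
    using assms n by (metis le_less order.strict_trans1)
  then show ?thesis
    using first_entry_eq_iff[OF n] n_def by metis
qed

section \<open>The generated filtration and its stopping times\<close>

lemma space_generated_sigma[simp]: "space (generated_sigma M X n) = space M"
  unfolding generated_sigma_def by (rule space_measure_of) auto

lemma sets_generated_sigma:
  "sets (generated_sigma M X n) =
     sigma_sets (space M) {X i -` B \<inter> space M | i B. i \<le> n \<and> B \<in> sets borel}"
  unfolding generated_sigma_def by (rule sets_measure_of) auto

lemma in_generated_sigma:
  "i \<le> n \<Longrightarrow> B \<in> sets borel \<Longrightarrow> X i -` B \<inter> space M \<in> sets (generated_sigma M X n)"
  unfolding sets_generated_sigma by (rule sigma_sets.Basic) auto

lemma generated_sigma_mono:
  "m \<le> n \<Longrightarrow> sets (generated_sigma M X m) \<subseteq> sets (generated_sigma M X n)"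
  unfolding sets_generated_sigma by (rule sigma_sets_mono') (auto intro: order_trans)

lemma subalgebra_generated_sigma:
  assumes "\<And>i. i \<le> n \<Longrightarrow> X i \<in> borel_measurable M"
  shows "subalgebra M (generated_sigma M X n)"
  unfolding subalgebra_def sets_generated_sigma
  using assms by (auto intro!: sets.sigma_sets_subset measurable_sets)

text \<open>By \<open>first_entry_eq_iff\<close>, stopping at \<open>n\<close> is decided by the
  positions up to time \<open>n\<close>.\<close>

lemma first_entry_stopping_time:
  assumes "\<And>n. n < N \<Longrightarrow> D n \<in> sets borel"
  shows "first_entry X N D \<in> stopping_times M X N"
proof -
  have "{\<omega>\<in>space M. first_entry X N D \<omega> = n} \<in> sets (generated_sigma M X n)" if n: "n \<le> N" for n
  proof -
    let ?G = "generated_sigma M X n"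
    have D: "X j -` D j \<inter> space M \<in> sets ?G" if "j \<le> n" "j < N" for j
      using that assms by (intro in_generated_sigma) auto
    have top: "space M \<in> sets ?G"
      using sets.top[of ?G] by simp
    have "{\<omega>\<in>space M. first_entry X N D \<omega> = n} =
        (if n = N then space M else X n -` D n \<inter> space M) - (\<Union>j<n. X j -` D j \<inter> space M)"
      unfolding first_entry_eq_iff[OF n] by auto
    also have "\<dots> \<in> sets ?G"
      using D n top by (intro sets.Diff sets.finite_UN) auto
    finally show ?thesis .
  qed
  then show ?thesis
    unfolding stopping_times_def by (auto simp: first_entry_le)
qed

text \<open>Only the summand at the entry time can survive: earlier ones have network value
  \<open>0\<close>, and later ones contain the vanishing factor of the entry time.\<close>

lemma network_stopping_time_eq_first_entry:
  fixes X :: "nat \<Rightarrow> 'a \<Rightarrow> real ^ 'd"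
  assumes "\<And>x :: real ^ 'd. network I q (\<theta> N) x = 1"
  shows "network_stopping_time N X I q \<theta> = first_entry X N (\<lambda>n. {x. network I q (\<theta> n) x = 1})"
proof
  fix \<omega>
  let ?e = "\<lambda>n. network I q (\<theta> n) (X n \<omega>)"
  let ?T = "first_entry X N (\<lambda>n. {x. network I q (\<theta> n) x = 1}) \<omega>"
  have T: "?T \<le> N"
    by (rule first_entry_le)
  note entry = first_entry_eq_iff[THEN iffD1, OF T refl]
  have stop: "?e ?T = 1"
    using entry[THEN conjunct1] assms by (elim disjE) simp_all
  have before: "?e j = 0" if "j < ?T" for j
    using entry[THEN conjunct2] that
    by (auto simp: network_def indicator_def split: if_splits)
  have "n * ?e n * (\<Prod>j=0..<n. 1 - ?e j) = (if n = ?T then ?T else 0)" for n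
  proof (cases n ?T rule: linorder_cases)
    case less
    then show ?thesis
      using before by simp
  next
    case equal
    then have "(\<Prod>j=0..<n. 1 - ?e j) = 1"
      using before by (intro prod.neutral) auto
    then show ?thesis
      using equal stop by simp
  next
    case greater
    then have "(\<Prod>j=0..<n. 1 - ?e j) = 0"
      using stop by (intro prod_zero bexI[of _ ?T]) auto
    then show ?thesis
      using greater by simp
  qed
  then show "network_stopping_time N X I q \<theta> \<omega> = ?T"
    \<comment> \<open>The sum starts at \<open>1\<close>; for an entry at time \<open>0\<close> all
      its summands vanish, which gives the correct value \<open>0\<close>.\<close>
    using T by (cases "?T = 0") (simp_all add: network_stopping_time_def)
qed

section \<open>Optimal stopping of Markov processes\<close>

text \<open>Conditional expectation is self-adjoint. The projected indicator lies between
  \<open>0\<close> and \<open>1\<close> almost everywhere, so integrability of \<open>Y\<close>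
  suffices for the products.\<close>

lemma (in finite_measure_subalgebra) integral_cond_exp_indicator_mult:
  assumes A[measurable]: "A \<in> sets M" and Y[measurable]: "integrable M Y"
  shows "integrable M (\<lambda>x. real_cond_exp M F (indicator A) x * Y x)"
    and "(\<integral>x. real_cond_exp M F (indicator A) x * Y x \<partial>M) = (\<integral>x. indicator A x * real_cond_exp M F Y x \<partial>M)"
proof -
  let ?\<phi> = "real_cond_exp M F (indicator A)"
  have ind: "integrable M (indicator A :: 'a \<Rightarrow> real)"
    using A by (simp add: emeasure_eq_measure)
  have "AE x in M. 0 \<le> ?\<phi> x"
    by (rule real_cond_exp_ge_c[OF ind]) auto
  moreover have "AE x in M. ?\<phi> x \<le> 1"
    by (rule real_cond_exp_le_c[OF ind]) (auto simp: indicator_def)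
  ultimately have bound: "AE x in M. \<bar>?\<phi> x\<bar> \<le> 1"
    by eventually_elim auto
  show int: "integrable M (\<lambda>x. ?\<phi> x * Y x)"
  proof (rule Bochner_Integration.integrable_bound[OF Y])
    show "AE x in M. norm (?\<phi> x * Y x) \<le> norm (Y x)"
      using bound by eventually_elim (auto simp: abs_mult intro: mult_left_le_one_le)
  qed measurable
  have EY: "integrable M (real_cond_exp M F Y)"
    using Y by (rule real_cond_exp_int)
  have "(\<integral>x. ?\<phi> x * Y x \<partial>M) = (\<integral>x. ?\<phi> x * real_cond_exp M F Y x \<partial>M)"
    by (rule real_cond_exp_intg(2)[symmetric, OF int]) measurable
  also have "\<dots> = (\<integral>x. real_cond_exp M F Y x * ?\<phi> x \<partial>M)"
    by (simp add: mult.commute)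
  also have "\<dots> = (\<integral>x. real_cond_exp M F Y x * indicator A x \<partial>M)"
    using integrable_mult_indicator[OF A EY]
    by (intro real_cond_exp_intg(2)) (auto simp: mult.commute)
  finally show "(\<integral>x. ?\<phi> x * Y x \<partial>M) = (\<integral>x. indicator A x * real_cond_exp M F Y x \<partial>M)"
    by (simp add: mult.commute)
qed

locale markov_stopping = prob_space M
  for M :: "'a measure" +
  fixes X :: "nat \<Rightarrow> 'a \<Rightarrow> 'b::topological_space" and g :: "nat \<Rightarrow> 'b \<Rightarrow> real" and N :: nat
  assumes markov: "markov_process M X N"
    and g_measurable: "\<And>n. n \<le> N \<Longrightarrow> g n \<in> borel_measurable borel"
    and g_integrable: "\<And>n. n \<le> N \<Longrightarrow> integrable M (\<lambda>\<omega>. g n (X n \<omega>))"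
begin

abbreviation past :: "nat \<Rightarrow> 'a measure" where
  "past n \<equiv> generated_sigma M X n"

abbreviation present :: "nat \<Rightarrow> 'a measure" where
  "present n \<equiv> vimage_algebra (space M) (X n) borel"

lemma X_measurable: "n \<le> N \<Longrightarrow> X n \<in> borel_measurable M"
  using markov unfolding markov_process_def by blast

lemma sets_present: "sets (present n) = {X n -` B \<inter> space M | B. B \<in> sets borel}"
  by (rule sets_vimage_algebra2) simp

lemma past_subalgebra: "n \<le> N \<Longrightarrow> finite_measure_subalgebra M (past n)"
  by unfold_locales (auto intro!: subalgebra_generated_sigma X_measurable)

lemma present_subalgebra: "n \<le> N \<Longrightarrow> finite_measure_subalgebra M (present n)"
  by unfold_locales (auto simp: subalgebra_def sets_present intro!: measurable_sets X_measurable)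

text \<open>The Markov property is assumed for events of the next state only. This is its integrated
  form for integrable functions of the next state, reached by linearity and dominated
  convergence.\<close>

lemma integral_past_eq_cond_exp_present:
  assumes n: "n < N" and A: "A \<in> sets (past n)"
    and Y: "Y \<in> borel_measurable (present (Suc n))" "integrable M Y"
  shows "(\<integral>\<omega>. indicator A \<omega> * Y \<omega> \<partial>M) = (\<integral>\<omega>. indicator A \<omega> * real_cond_exp M (present n) Y \<omega> \<partial>M)"
proof -
  interpret past: finite_measure_subalgebra M "past n"
    using n by (intro past_subalgebra) simp
  interpret present: finite_measure_subalgebra M "present n"
    using n by (intro present_subalgebra) simp
  interpret future: finite_measure_subalgebra M "present (Suc n)"
    using n by (intro present_subalgebra) simp
  have AM: "A \<in> sets M"
    using A past.subalg by (auto simp: subalgebra_def)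
  let ?\<phi> = "real_cond_exp M (present n) (indicator A)"
  \<comment> \<open>Over the measure restricted to \<open>present (Suc n)\<close>, the induction on
    integrable functions starts from preimages under \<open>X (Suc n)\<close>, exactly the events
    that the Markov assumption covers.\<close>
  have "integrable (restr_to_subalg M (present (Suc n))) Y"
    using future.subalg Y by (rule integrable_in_subalg)
  \<comment> \<open>Moving the projection onto the indicator leaves both sides linear in \<open>Y\<close> with bounded weights.\<close>
  then have "(\<integral>\<omega>. indicator A \<omega> * Y \<omega> \<partial>M) = (\<integral>\<omega>. ?\<phi> \<omega> * Y \<omega> \<partial>M)"
  proof (induction Y)
    case (base S c)
    then obtain B where B: "B \<in> sets borel" "S = X (Suc n) -` B \<inter> space M"
      by (auto simp: sets_restr_to_subalg[OF future.subalg] sets_present)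
    have SM: "S \<in> sets M"
      unfolding B using X_measurable[OF Suc_leI[OF n]] B(1) by (rule measurable_sets)
    have ind: "integrable M (indicator S :: 'a \<Rightarrow> real)"
      using SM by (simp add: emeasure_eq_measure)
    have "AE \<omega> in M. real_cond_exp M (past n) (indicator S) \<omega> = real_cond_exp M (present n) (indicator S) \<omega>"
      using markov n B unfolding markov_process_def cond_prob_given_def by blast
    then have "(\<integral>\<omega>. indicator A \<omega> * real_cond_exp M (past n) (indicator S) \<omega> \<partial>M) =
        (\<integral>\<omega>. indicator A \<omega> * real_cond_exp M (present n) (indicator S) \<omega> \<partial>M)"
      using AM by (intro integral_cong_AE) auto
    moreover have "(\<integral>\<omega>. indicator A \<omega> * real_cond_exp M (past n) (indicator S) \<omega> \<partial>M) =
        (\<integral>\<omega>. indicator A \<omega> * indicator S \<omega> \<partial>M)"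
      using A AM SM integrable_mult_indicator[OF AM ind] by (intro past.real_cond_exp_intg(2)) auto
    ultimately have "(\<integral>\<omega>. indicator A \<omega> * indicator S \<omega> \<partial>M) = (\<integral>\<omega>. ?\<phi> \<omega> * indicator S \<omega> \<partial>M)"
      using present.integral_cond_exp_indicator_mult(2)[OF AM ind] by simp
    then show ?case
      by (simp flip: mult.assoc)
  next
    case (add u v)
    have M: "integrable M u" "integrable M v"
      using add(1,2) integrable_from_subalg[OF future.subalg] by blast+
    have "integrable M (\<lambda>\<omega>. indicator A \<omega> * w \<omega>)" "integrable M (\<lambda>\<omega>. ?\<phi> \<omega> * w \<omega>)"
      if "integrable M w" for w
      using integrable_mult_indicator[OF AM that] present.integral_cond_exp_indicator_mult(1)[OF AM that]
      by auto
    then show ?case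
      using M add.IH by (simp add: distrib_left)
  next
    case (lim u s)
    have u: "integrable M u" and s: "\<And>i. integrable M (s i)"
      using lim integrable_from_subalg[OF future.subalg] by blast+
    have pw: "(\<lambda>i. s i \<omega>) \<longlonglongrightarrow> u \<omega>" "norm (s i \<omega>) \<le> 2 * norm (u \<omega>)" if "\<omega> \<in> space M" for i \<omega>
      using lim that by (auto simp: space_restr_to_subalg)
    \<comment> \<open>The weight \<open>w\<close> is kept general because the limit is taken once
      with \<open>indicator A\<close> and once with \<open>?\<phi>\<close>.\<close>
    have conv: "(\<lambda>i. \<integral>\<omega>. w \<omega> * s i \<omega> \<partial>M) \<longlonglongrightarrow> (\<integral>\<omega>. w \<omega> * u \<omega> \<partial>M)"
      if "integrable M (\<lambda>\<omega>. w \<omega> * u \<omega>)" and [measurable]: "w \<in> borel_measurable M" for w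
    proof (rule integral_dominated_convergence[where w = "\<lambda>\<omega>. 2 * norm (w \<omega> * u \<omega>)"])
      show "AE \<omega> in M. (\<lambda>i. w \<omega> * s i \<omega>) \<longlonglongrightarrow> w \<omega> * u \<omega>"
        using pw by (auto intro!: tendsto_intros)
      show "AE \<omega> in M. norm (w \<omega> * s i \<omega>) \<le> 2 * norm (w \<omega> * u \<omega>)" for i
      proof (rule AE_I2)
        fix \<omega> assume "\<omega> \<in> space M"
        then show "norm (w \<omega> * s i \<omega>) \<le> 2 * norm (w \<omega> * u \<omega>)"
          using mult_left_mono[OF pw(2), of \<omega> "\<bar>w \<omega>\<bar>"] by (simp add: abs_mult mult.left_commute)
      qed
    qed (use u s that in auto)
    have "(\<lambda>i. \<integral>\<omega>. indicator A \<omega> * s i \<omega> \<partial>M) \<longlonglongrightarrow> (\<integral>\<omega>. indicator A \<omega> * u \<omega> \<partial>M)"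
      using integrable_mult_indicator[OF AM u] AM by (intro conv) auto
    moreover have "(\<lambda>i. \<integral>\<omega>. ?\<phi> \<omega> * s i \<omega> \<partial>M) \<longlonglongrightarrow> (\<integral>\<omega>. ?\<phi> \<omega> * u \<omega> \<partial>M)"
      using present.integral_cond_exp_indicator_mult(1)[OF AM u] by (intro conv) auto
    ultimately show ?case
      unfolding lim.IH by (rule LIMSEQ_unique)
  qed
  then show ?thesis
    using present.integral_cond_exp_indicator_mult(2)[OF AM Y(2)] by simp
qed

text \<open>\<open>snell_rev k\<close> is the value with \<open>k\<close> steps to go, that is, at time \<open>N - k\<close>. Conditioning on
  \<open>X n\<close> alone and keeping all values as random variables avoids transition kernels: the
  stopping regions of \<open>exists_optimal_regions\<close> come from measurability with respect to \<open>present n\<close>.\<close>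

fun snell_rev :: "nat \<Rightarrow> 'a \<Rightarrow> real" where
  "snell_rev 0 = (\<lambda>\<omega>. g N (X N \<omega>))"
| "snell_rev (Suc k) = (\<lambda>\<omega>. max (g (N - Suc k) (X (N - Suc k) \<omega>))
     (real_cond_exp M (present (N - Suc k)) (snell_rev k) \<omega>))"

text \<open>The Snell envelope, with time running forward again.\<close>

definition snell :: "nat \<Rightarrow> 'a \<Rightarrow> real" where
  "snell n = snell_rev (N - n)"

definition continuation :: "nat \<Rightarrow> 'a \<Rightarrow> real" where
  "continuation n = real_cond_exp M (present n) (snell (Suc n))"

lemma snell_N: "snell N = (\<lambda>\<omega>. g N (X N \<omega>))"
  by (simp add: snell_def)

lemma snell_eq_max: "n < N \<Longrightarrow> snell n = (\<lambda>\<omega>. max (g n (X n \<omega>)) (continuation n \<omega>))"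
  by (cases "N - n") (auto simp: snell_def continuation_def Suc_diff_Suc[symmetric])

lemma reward_present: "n \<le> N \<Longrightarrow> (\<lambda>\<omega>. g n (X n \<omega>)) \<in> borel_measurable (present n)"
  by (rule measurable_compose[OF measurable_vimage_algebra1 g_measurable]) auto

lemma continuation_measurable: "continuation n \<in> borel_measurable (present n)"
  unfolding continuation_def by (rule borel_measurable_cond_exp)

lemma snell_present: "n \<le> N \<Longrightarrow> snell n \<in> borel_measurable (present n)"
  using reward_present continuation_measurable
  by (cases "n = N") (auto simp: snell_N snell_eq_max)

lemma snell_integrable: "n \<le> N \<Longrightarrow> integrable M (snell n)"
proof (induction rule: inc_induct)
  case base
  then show ?case
    using g_integrable[of N] by (simp add: snell_N)
next
  case (step n)
  interpret finite_measure_subalgebra M "present n"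
    using step by (intro present_subalgebra) simp
  show ?case
    using step g_integrable[of n] real_cond_exp_int(1)[of "snell (Suc n)"]
    by (simp add: snell_eq_max continuation_def)
qed

lemma continuation_integrable:
  assumes "n < N"
  shows "integrable M (continuation n)"
proof -
  interpret finite_measure_subalgebra M "present n"
    using assms by (intro present_subalgebra) simp
  show ?thesis
    unfolding continuation_def using assms by (intro real_cond_exp_int snell_integrable) auto
qed

section \<open>Regret of a stopping time and optimality\<close>

definition stop_reward :: "('a \<Rightarrow> nat) \<Rightarrow> 'a \<Rightarrow> real" where
  "stop_reward \<tau> \<omega> = g (\<tau> \<omega>) (X (\<tau> \<omega>) \<omega>)"

lemma stopping_time_sets:
  assumes "\<tau> \<in> stopping_times M X N" and "n \<le> N"
  shows "{\<omega>\<in>space M. n < \<tau> \<omega>} \<in> sets (past n)"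
    and "{\<omega>\<in>space M. \<tau> \<omega> = n} \<in> sets M" and "{\<omega>\<in>space M. n < \<tau> \<omega>} \<in> sets M"
proof -
  interpret finite_measure_subalgebra M "past n"
    using assms(2) by (rule past_subalgebra)
  have eq: "{\<omega>\<in>space M. \<tau> \<omega> = j} \<in> sets (past n)" if "j \<le> n" for j
    using assms that generated_sigma_mono[OF that, of M X] unfolding stopping_times_def by auto
  have top: "space M \<in> sets (past n)"
    using sets.top[of "past n"] by simp
  have "{\<omega>\<in>space M. n < \<tau> \<omega>} = space M - (\<Union>j\<le>n. {\<omega>\<in>space M. \<tau> \<omega> = j})"
    by (auto simp: not_le)
  also have "\<dots> \<in> sets (past n)"
    using eq top by (intro sets.Diff sets.finite_UN) auto
  finally show "{\<omega>\<in>space M. n < \<tau> \<omega>} \<in> sets (past n)" .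
  then show "{\<omega>\<in>space M. n < \<tau> \<omega>} \<in> sets M"
    using subalg by (auto simp: subalgebra_def)
  show "{\<omega>\<in>space M. \<tau> \<omega> = n} \<in> sets M"
    using eq[of n] subalg by (auto simp: subalgebra_def)
qed

text \<open>The reward splits along the finitely many values of \<open>\<tau>\<close> into
  integrable pieces.\<close>

lemma stop_reward_integrable:
  assumes "\<tau> \<in> stopping_times M X N"
  shows "integrable M (stop_reward \<tau>)"
proof -
  have "integrable M (\<lambda>\<omega>. \<Sum>n\<le>N. indicator {\<omega>\<in>space M. \<tau> \<omega> = n} \<omega> *\<^sub>R g n (X n \<omega>))"
    using stopping_time_sets[OF assms] g_integrable
    by (intro Bochner_Integration.integrable_sum integrable_mult_indicator) auto
  also have "?this \<longleftrightarrow> integrable M (stop_reward \<tau>)"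
  proof (rule Bochner_Integration.integrable_cong[OF refl])
    fix \<omega> assume \<omega>: "\<omega> \<in> space M"
    then have "\<tau> \<omega> \<le> N"
      using assms by (auto simp: stopping_times_def)
    have "(\<Sum>n\<le>N. indicator {\<omega>\<in>space M. \<tau> \<omega> = n} \<omega> *\<^sub>R g n (X n \<omega>)) =
        (\<Sum>n\<le>N. if n = \<tau> \<omega> then g n (X n \<omega>) else 0)"
      using \<omega> by (intro sum.cong) auto
    then show "(\<Sum>n\<le>N. indicator {\<omega>\<in>space M. \<tau> \<omega> = n} \<omega> *\<^sub>R g n (X n \<omega>)) = stop_reward \<tau> \<omega>"
      using \<open>\<tau> \<omega> \<le> N\<close> by (simp add: stop_reward_def)
  qed
  finally show ?thesis .
qed

text \<open>Expected shortfall against the Snell envelope on the paths that have not stopped before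
  \<open>k\<close>. Computed backwards from \<open>regret_N\<close>, it compares every stopping time
  with the common value \<open>snell 0\<close>.\<close>

definition regret :: "('a \<Rightarrow> nat) \<Rightarrow> nat \<Rightarrow> real" where
  "regret \<tau> k = (\<integral>\<omega>. indicator {\<omega>\<in>space M. k \<le> \<tau> \<omega>} \<omega> * (snell k \<omega> - stop_reward \<tau> \<omega>) \<partial>M)"

lemma regret_N:
  assumes "\<tau> \<in> stopping_times M X N"
  shows "regret \<tau> N = 0"
proof -
  have "regret \<tau> N = (\<integral>\<omega>. 0 \<partial>M)"
    unfolding regret_def
  proof (rule Bochner_Integration.integral_cong[OF refl])
    fix \<omega> assume "\<omega> \<in> space M"
    then have "\<tau> \<omega> \<le> N"
      using assms by (auto simp: stopping_times_def)
    then show "indicator {\<omega>\<in>space M. N \<le> \<tau> \<omega>} \<omega> * (snell N \<omega> - stop_reward \<tau> \<omega>) = 0"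
      by (cases "\<tau> \<omega> = N") (auto simp: stop_reward_def snell_N)
  qed
  then show ?thesis by simp
qed

lemma regret_0:
  assumes "\<tau> \<in> stopping_times M X N"
  shows "expected_reward M X g \<tau> = (\<integral>\<omega>. snell 0 \<omega> \<partial>M) - regret \<tau> 0"
proof -
  have "regret \<tau> 0 = (\<integral>\<omega>. snell 0 \<omega> - stop_reward \<tau> \<omega> \<partial>M)"
    unfolding regret_def by (rule Bochner_Integration.integral_cong) auto
  also have "\<dots> = (\<integral>\<omega>. snell 0 \<omega> \<partial>M) - (\<integral>\<omega>. stop_reward \<tau> \<omega> \<partial>M)"
    using snell_integrable[of 0] stop_reward_integrable[OF assms] by simp
  finally show ?thesis
    by (simp add: expected_reward_def stop_reward_def)
qed

text \<open>The first integral is the loss from stopping at \<open>k\<close>, the second the loss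
  from continuing. Replacing \<open>continuation k\<close> by \<open>snell (Suc k)\<close> costs
  nothing on average.\<close>

lemma regret_step:
  assumes \<tau>: "\<tau> \<in> stopping_times M X N" and k: "k < N"
  shows "regret \<tau> k = (\<integral>\<omega>. indicator {\<omega>\<in>space M. \<tau> \<omega> = k} \<omega> * (snell k \<omega> - g k (X k \<omega>)) \<partial>M)
     + (\<integral>\<omega>. indicator {\<omega>\<in>space M. k < \<tau> \<omega>} \<omega> * (snell k \<omega> - continuation k \<omega>) \<partial>M)
     + regret \<tau> (Suc k)"
proof -
  let ?S = "{\<omega>\<in>space M. \<tau> \<omega> = k}" and ?C = "{\<omega>\<in>space M. k < \<tau> \<omega>}"
  note S = stopping_time_sets[OF \<tau> less_imp_le[OF k]]
  have int: "integrable M (\<lambda>\<omega>. indicator ?S \<omega> * w \<omega>)" "integrable M (\<lambda>\<omega>. indicator ?C \<omega> * w \<omega>)"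
    if "integrable M w" for w :: "'a \<Rightarrow> real"
    using integrable_mult_indicator[OF S(2) that] integrable_mult_indicator[OF S(3) that] by simp_all
  have I: "integrable M (snell k)" "integrable M (snell (Suc k))" "integrable M (continuation k)"
    "integrable M (\<lambda>\<omega>. g k (X k \<omega>))" "integrable M (stop_reward \<tau>)"
    using k snell_integrable[of k] snell_integrable[of "Suc k"] continuation_integrable[OF k]
      g_integrable[of k] stop_reward_integrable[OF \<tau>] by simp_all
  \<comment> \<open>The event of continuing lies in the past at \<open>k\<close>, so over it
    \<open>snell (Suc k)\<close> and its projection on the present have equal integrals.\<close>
  have zero: "(\<integral>\<omega>. indicator ?C \<omega> * (continuation k \<omega> - snell (Suc k) \<omega>) \<partial>M) = 0"
    using integral_past_eq_cond_exp_present[OF k S(1) snell_present I(2)] k int I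
    by (simp add: right_diff_distrib continuation_def)
  have "regret \<tau> k = (\<integral>\<omega>. indicator ?S \<omega> * (snell k \<omega> - g k (X k \<omega>))
      + (indicator ?C \<omega> * (snell k \<omega> - continuation k \<omega>)
      + (indicator ?C \<omega> * (continuation k \<omega> - snell (Suc k) \<omega>)
      + indicator ?C \<omega> * (snell (Suc k) \<omega> - stop_reward \<tau> \<omega>))) \<partial>M)"
    unfolding regret_def
    by (rule Bochner_Integration.integral_cong)
      (auto simp: indicator_def stop_reward_def)
  also have "\<dots> = (\<integral>\<omega>. indicator ?S \<omega> * (snell k \<omega> - g k (X k \<omega>)) \<partial>M)
      + ((\<integral>\<omega>. indicator ?C \<omega> * (snell k \<omega> - continuation k \<omega>) \<partial>M)
      + ((\<integral>\<omega>. indicator ?C \<omega> * (continuation k \<omega> - snell (Suc k) \<omega>) \<partial>M)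
      + (\<integral>\<omega>. indicator ?C \<omega> * (snell (Suc k) \<omega> - stop_reward \<tau> \<omega>) \<partial>M)))"
    using I by (subst Bochner_Integration.integral_add; (intro Bochner_Integration.integrable_add int Bochner_Integration.integrable_diff)?; simp?)+
  finally show ?thesis
    unfolding zero by (simp add: regret_def Suc_le_eq)
qed

text \<open>\<open>snell\<close> is the maximum of reward and continuation value, so neither loss in
  \<open>regret_step\<close> is negative.\<close>

lemma regret_nonneg:
  assumes "\<tau> \<in> stopping_times M X N" and "k \<le> N"
  shows "0 \<le> regret \<tau> k"
  using assms(2)
proof (induction rule: inc_induct)
  case base
  show ?case
    using regret_N[OF assms(1)] by simp
next
  case (step n)
  then show ?case
    unfolding regret_step[OF assms(1) step(2)]
    by (intro add_nonneg_nonneg Bochner_Integration.integral_nonneg)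
       (auto simp: snell_eq_max indicator_def)
qed

text \<open>Stopping where the reward reaches the continuation value makes both losses in
  \<open>regret_step\<close> vanish. This rule has zero regret, and no rule has negative
  regret.\<close>

lemma exists_optimal_regions:
  "\<exists>D. (\<forall>n. D n \<in> sets borel) \<and>
     (\<forall>\<tau>\<in>stopping_times M X N.
        expected_reward M X g \<tau> \<le> expected_reward M X g (first_entry X N D))"
proof -
  \<comment> \<open>The comparison event belongs to \<open>present n\<close>, hence is a preimage of
    a Borel set under \<open>X n\<close>. The guard \<open>n < N\<close> lets the choice of regions
    range over all \<open>n\<close>.\<close>
  have "\<exists>D\<in>sets borel. n < N \<longrightarrow> X n -` D \<inter> space M = {\<omega>\<in>space M. continuation n \<omega> \<le> g n (X n \<omega>)}" for n
  proof (cases "n < N")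
    case True
    have "{\<omega>\<in>space (present n). continuation n \<omega> \<le> g n (X n \<omega>)} \<in> sets (present n)"
      using True continuation_measurable by (intro borel_measurable_le reward_present) auto
    then show ?thesis
      unfolding sets_present by auto
  qed auto
  then obtain D where D: "\<And>n. D n \<in> sets borel"
    "\<And>n. n < N \<Longrightarrow> X n -` D n \<inter> space M = {\<omega>\<in>space M. continuation n \<omega> \<le> g n (X n \<omega>)}"
    by metis
  have in_D: "X n \<omega> \<in> D n \<longleftrightarrow> continuation n \<omega> \<le> g n (X n \<omega>)" if "n < N" "\<omega> \<in> space M" for n \<omega>
    using D(2)[OF that(1)] that(2) by blast
  let ?\<tau> = "first_entry X N D"
  have \<tau>: "?\<tau> \<in> stopping_times M X N"
    using D by (intro first_entry_stopping_time)
  have "regret ?\<tau> k = 0" if "k \<le> N" for k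
    using that
  proof (induction rule: inc_induct)
    case base
    show ?case
      using regret_N[OF \<tau>] .
  next
    case (step n)
    have "(\<lambda>\<omega>. indicator {\<omega>\<in>space M. ?\<tau> \<omega> = n} \<omega> * (snell n \<omega> - g n (X n \<omega>))) = (\<lambda>_. 0)"
    proof
      fix \<omega>
      show "indicator {\<omega>\<in>space M. ?\<tau> \<omega> = n} \<omega> * (snell n \<omega> - g n (X n \<omega>)) = 0"
      proof (cases "\<omega> \<in> space M \<and> ?\<tau> \<omega> = n")
        case True
        then have "X n \<omega> \<in> D n"
          using first_entry_eq_iff[of n N X D \<omega>] step by auto
        then show ?thesis
          using True in_D step by (simp add: snell_eq_max)
      qed simp
    qed
    moreover have "(\<lambda>\<omega>. indicator {\<omega>\<in>space M. n < ?\<tau> \<omega>} \<omega> * (snell n \<omega> - continuation n \<omega>)) = (\<lambda>_. 0)"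
    proof
      fix \<omega>
      show "indicator {\<omega>\<in>space M. n < ?\<tau> \<omega>} \<omega> * (snell n \<omega> - continuation n \<omega>) = 0"
      proof (cases "\<omega> \<in> space M \<and> n < ?\<tau> \<omega>")
        case True
        \<comment> \<open>The characterization is applied with the entry time itself in place of
          \<open>n\<close>: no region was hit before it.\<close>
        then have "X n \<omega> \<notin> D n"
          using first_entry_eq_iff[OF first_entry_le, of X N D \<omega> X D \<omega>] by auto
        then show ?thesis
          using True in_D step by (simp add: snell_eq_max)
      qed simp
    qed
    ultimately show ?case
      using step by (simp add: regret_step[OF \<tau>])
  qed
  then have "expected_reward M X g \<tau>' \<le> expected_reward M X g ?\<tau>" if "\<tau>' \<in> stopping_times M X N" for \<tau>'
    using regret_0[OF that] regret_0[OF \<tau>] regret_nonneg[OF that, of 0] by simp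
  then show ?thesis
    using D by blast
qed

section \<open>Stability of rewards under changes of the stopping regions\<close>

definition reward_bound :: "'a \<Rightarrow> real" where
  "reward_bound \<omega> = (\<Sum>n\<le>N. \<bar>g n (X n \<omega>)\<bar>)"

lemma reward_bound_integrable: "integrable M reward_bound"
  unfolding reward_bound_def[abs_def] using g_integrable by (intro Bochner_Integration.integrable_sum integrable_abs) auto

lemma reward_bound_nonneg: "0 \<le> reward_bound \<omega>"
  unfolding reward_bound_def by (rule sum_nonneg) simp

lemma stop_reward_le_bound: "\<tau> \<omega> \<le> N \<Longrightarrow> \<bar>stop_reward \<tau> \<omega>\<bar> \<le> reward_bound \<omega>"
  unfolding reward_bound_def stop_reward_def
  by (rule member_le_sum[of "\<tau> \<omega>" "{..N}" "\<lambda>n. \<bar>g n (X n \<omega>)\<bar>"]) auto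

text \<open>The law of \<open>X n\<close> weighted with the integrable dominating reward: approximating the stopping
  regions with respect to it controls the rewards directly, without uniform integrability.\<close>

definition reward_law :: "nat \<Rightarrow> 'b measure" where
  "reward_law n = distr (density M (\<lambda>\<omega>. ennreal (reward_bound \<omega>))) borel (X n)"

lemma integrable_reward_bound_indicator:
  assumes "n \<le> N" and "B \<in> sets borel"
  shows "integrable M (\<lambda>\<omega>. reward_bound \<omega> * indicator B (X n \<omega>))"
proof -
  note [measurable] = X_measurable[OF assms(1)] borel_measurable_integrable[OF reward_bound_integrable] assms(2)
  show ?thesis
    by (rule Bochner_Integration.integrable_bound[OF reward_bound_integrable]) (auto simp: indicator_def)
qed

lemma emeasure_reward_law:
  assumes "n \<le> N" and "B \<in> sets borel"
  shows "emeasure (reward_law n) B = ennreal (\<integral>\<omega>. reward_bound \<omega> * indicator B (X n \<omega>) \<partial>M)"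
proof -
  note [measurable] = X_measurable[OF assms(1)] borel_measurable_integrable[OF reward_bound_integrable] assms(2)
  have "emeasure (reward_law n) B =
      (\<integral>\<^sup>+\<omega>. ennreal (reward_bound \<omega>) * indicator (X n -` B \<inter> space M) \<omega> \<partial>M)"
    unfolding reward_law_def by (subst emeasure_distr) (auto simp: emeasure_density)
  also have "\<dots> = (\<integral>\<^sup>+\<omega>. ennreal (reward_bound \<omega> * indicator B (X n \<omega>)) \<partial>M)"
    by (rule nn_integral_cong) (auto simp: indicator_def)
  also have "\<dots> = ennreal (\<integral>\<omega>. reward_bound \<omega> * indicator B (X n \<omega>) \<partial>M)"
    using integrable_reward_bound_indicator[OF assms] by (rule nn_integral_eq_integral) (auto simp: reward_bound_nonneg)
  finally show ?thesis .
qed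

lemma finite_reward_law: "n \<le> N \<Longrightarrow> finite_measure (reward_law n)"
  using emeasure_reward_law[of n UNIV] by (intro finite_measureI) (simp add: reward_law_def)

lemma measure_reward_law:
  assumes "n \<le> N" and "B \<in> sets borel"
  shows "measure (reward_law n) B = (\<integral>\<omega>. reward_bound \<omega> * indicator B (X n \<omega>) \<partial>M)"
  unfolding measure_def emeasure_reward_law[OF assms]
  by (simp add: reward_bound_nonneg)

text \<open>Paths on which the regions agree stop at the same time. On any other path the rewards
  differ by at most twice \<open>reward_bound\<close>, which is charged to a time where the regions
  disagree; integration turns this into \<open>reward_law\<close>.\<close>

lemma expected_reward_first_entry_diff:
  assumes D: "\<And>n. n < N \<Longrightarrow> D n \<in> sets borel" and D': "\<And>n. n < N \<Longrightarrow> D' n \<in> sets borel"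
  shows "expected_reward M X g (first_entry X N D) - expected_reward M X g (first_entry X N D')
    \<le> (\<Sum>n<N. 2 * measure (reward_law n) {x. (x \<in> D n) \<noteq> (x \<in> D' n)})"
proof -
  let ?\<tau> = "first_entry X N D" and ?\<tau>' = "first_entry X N D'"
  let ?S = "\<lambda>n. {x. (x \<in> D n) \<noteq> (x \<in> D' n)}"
  let ?I = "\<lambda>n \<omega>. reward_bound \<omega> * indicator (?S n) (X n \<omega>)"
  have S: "?S n \<in> sets borel" if "n < N" for n
  proof -
    have "?S n = (D n - D' n) \<union> (D' n - D n)"
      by auto
    then show ?thesis
      using D[OF that] D'[OF that] by auto
  qed
  have int: "integrable M (stop_reward ?\<tau>)" "integrable M (stop_reward ?\<tau>')"
    using D D' by (auto intro!: stop_reward_integrable first_entry_stopping_time)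
  have intI: "integrable M (?I n)" if "n < N" for n
    using that S by (intro integrable_reward_bound_indicator) auto
  have pointwise: "stop_reward ?\<tau> \<omega> - stop_reward ?\<tau>' \<omega> \<le> (\<Sum>n<N. 2 * ?I n \<omega>)" for \<omega>
  proof (cases "\<forall>n<N. X n \<omega> \<in> D n \<longleftrightarrow> X n \<omega> \<in> D' n")
    case True
    then have "?\<tau> \<omega> = ?\<tau>' \<omega>"
      by (intro first_entry_cong) auto
    then show ?thesis
      by (auto simp: stop_reward_def intro!: sum_nonneg mult_nonneg_nonneg reward_bound_nonneg)
  next
    case False
    then obtain n where n: "n < N" "X n \<omega> \<in> ?S n"
      by auto
    have "stop_reward ?\<tau> \<omega> - stop_reward ?\<tau>' \<omega> \<le> 2 * reward_bound \<omega>"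
      using stop_reward_le_bound[of ?\<tau> \<omega>] stop_reward_le_bound[of ?\<tau>' \<omega>] first_entry_le by (smt (verit))
    also have "\<dots> = 2 * ?I n \<omega>"
      using n by (simp add: indicator_def)
    also have "\<dots> \<le> (\<Sum>n<N. 2 * ?I n \<omega>)"
      using n by (intro member_le_sum[of n "{..<N}" "\<lambda>n. 2 * ?I n \<omega>"])
        (auto intro!: mult_nonneg_nonneg reward_bound_nonneg)
    finally show ?thesis .
  qed
  have "expected_reward M X g ?\<tau> - expected_reward M X g ?\<tau>' =
      (\<integral>\<omega>. stop_reward ?\<tau> \<omega> - stop_reward ?\<tau>' \<omega> \<partial>M)"
    using int by (simp add: expected_reward_def flip: stop_reward_def)
  also have "\<dots> \<le> (\<integral>\<omega>. (\<Sum>n<N. 2 * ?I n \<omega>) \<partial>M)"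
    using int intI pointwise by (intro integral_mono) auto
  also have "\<dots> = (\<Sum>n<N. 2 * measure (reward_law n) (?S n))"
    using intI S by (subst Bochner_Integration.integral_sum) (auto simp: measure_reward_law)
  finally show ?thesis .
qed

end

section \<open>Near-optimal network stopping times\<close>

theorem corollary5:
  fixes M :: "'a measure"
    and X :: "nat \<Rightarrow> 'a \<Rightarrow> real ^ 'd"
    and g :: "nat \<Rightarrow> real ^ 'd \<Rightarrow> real"
    and N I :: nat
    and \<epsilon> :: real
  assumes "prob_space M"
    and "N \<ge> 1"
    and "markov_process M X N"
    and "case_prod g \<in> borel_measurable (count_space {0..N} \<Otimes>\<^sub>M borel)"
    and "\<And>n. n \<le> N \<Longrightarrow> integrable M (\<lambda>\<omega>. g n (X n \<omega>))"
    and "I \<ge> 2"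
    and "\<epsilon> > 0"
  shows "\<exists>q :: nat \<Rightarrow> nat. (\<forall>i\<in>{1..I-1}. q i > 0) \<and>
    (\<exists>\<theta> :: nat \<Rightarrow> real vec.
       (\<forall>n\<le>N. \<theta> n \<in> carrier_vec (num_params CARD('d) I q)) \<and>
       (\<forall>x :: real ^ 'd. network I q (\<theta> N) x = 1) \<and>
       network_stopping_time N X I q \<theta> \<in> stopping_times M X N \<and>
       expected_reward M X g (network_stopping_time N X I q \<theta>)
         \<ge> (SUP \<tau>\<in>stopping_times M X N. expected_reward M X g \<tau>) - \<epsilon>)"
proof -
  interpret prob_space M by fact
  interpret markov_stopping M X g N
  proof
    show "g n \<in> borel_measurable borel" if "n \<le> N" for n
    proof -
      have "Pair n \<in> borel \<rightarrow>\<^sub>M count_space {0..N} \<Otimes>\<^sub>M borel"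
        using that by (intro measurable_Pair1') simp
      from measurable_compose[OF this assms(4)] show ?thesis
        by simp
    qed
  qed (use assms in auto)
  obtain D where D: "\<And>n. D n \<in> sets borel"
    and opt: "\<And>\<tau>. \<tau> \<in> stopping_times M X N \<Longrightarrow>
      expected_reward M X g \<tau> \<le> expected_reward M X g (first_entry X N D)"
    using exists_optimal_regions by blast
  \<comment> \<open>There are \<open>N\<close> regions, each contributing at most
    \<open>2 * \<delta>\<close> to the loss, which adds up to \<open>\<epsilon>\<close>.\<close>
  define \<delta> where "\<delta> = \<epsilon> / (2 * real N)"
  have "\<delta> > 0"
    using assms by (simp add: \<delta>_def)
  \<comment> \<open>At time \<open>N\<close> the zero function is chosen: it satisfies
    \<open>0 \<le> h x\<close> everywhere, so its network is constantly \<open>1\<close>.\<close>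
  have "\<forall>n. \<exists>m h. shallow_net m h \<and> (n < N \<longrightarrow>
      measure (reward_law n) {x. (x \<in> D n) \<noteq> (0 \<le> h x)} < \<delta>) \<and> (n = N \<longrightarrow> h = (\<lambda>_. 0))"
    (is "\<forall>n. ?P n")
  proof
    fix n
    show "?P n"
    proof (cases "n < N")
      case True
      then show ?thesis
        using shallow_net_approximates_set[OF finite_reward_law _ D \<open>\<delta> > 0\<close>, of n n]
        by (auto simp: reward_law_def)
    next
      case False
      then show ?thesis
        using shallow_net_const by blast
    qed
  qed
  from choice[OF this] obtain k where "\<forall>n. \<exists>h. shallow_net (k n) h \<and> (n < N \<longrightarrow>
      measure (reward_law n) {x. (x \<in> D n) \<noteq> (0 \<le> h x)} < \<delta>) \<and> (n = N \<longrightarrow> h = (\<lambda>_. 0))"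
    by blast
  from choice[OF this] obtain h where kh: "\<And>n. shallow_net (k n) (h n)"
    "\<And>n. n < N \<Longrightarrow> measure (reward_law n) {x. (x \<in> D n) \<noteq> (0 \<le> h n x)} < \<delta>"
    "h N = (\<lambda>_. 0)"
    by blast
  \<comment> \<open>The networks of all times must share their widths, so they are padded to a common \<open>m > 0\<close>.\<close>
  define m where "m = Suc (\<Sum>n\<le>N. k n)"
  have "shallow_net m (h n)" if "n \<le> N" for n
    using kh(1) by (rule shallow_net_mono) (use that in \<open>auto simp: m_def intro!: le_SucI member_le_sum\<close>)
  then have "\<exists>\<theta>\<in>carrier_vec (num_params CARD('d) I (\<lambda>_. m)).
      \<forall>x. network I (\<lambda>_. m) \<theta> x = (if 0 \<le> h n x then 1 else 0)" if "n \<le> N" for n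
    using that \<open>I \<ge> 2\<close> by (intro network_realizes_shallow_net)
  then obtain \<theta> where \<theta>: "\<And>n. n \<le> N \<Longrightarrow> \<theta> n \<in> carrier_vec (num_params CARD('d) I (\<lambda>_. m))"
    "\<And>n x. n \<le> N \<Longrightarrow> network I (\<lambda>_. m) (\<theta> n) x = (if 0 \<le> h n x then 1 else 0)"
    by metis
  have one: "network I (\<lambda>_. m) (\<theta> N) x = 1" for x :: "real ^ 'd"
    using \<theta>(2)[of N x] kh(3) by simp
  define D' where "D' n = {x :: real ^ 'd. network I (\<lambda>_. m) (\<theta> n) x = 1}" for n
  have eq: "network_stopping_time N X I (\<lambda>_. m) \<theta> = first_entry X N D'"
    unfolding D'_def using one by (rule network_stopping_time_eq_first_entry)
  have D'_eq: "D' n = {x. 0 \<le> h n x}" if "n \<le> N" for n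
    using \<theta>(2)[OF that] by (auto simp: D'_def)
  have D': "D' n \<in> sets borel" if "n < N" for n
  proof -
    have "h n \<in> borel_measurable borel"
      using shallow_net_continuous[OF kh(1)] by (rule borel_measurable_continuous_onI)
    then show ?thesis
      using that by (simp add: D'_eq)
  qed
  have "expected_reward M X g (first_entry X N D) - expected_reward M X g (first_entry X N D')
      \<le> (\<Sum>n<N. 2 * measure (reward_law n) {x. (x \<in> D n) \<noteq> (x \<in> D' n)})"
    using D D' by (rule expected_reward_first_entry_diff)
  also have "\<dots> \<le> (\<Sum>n<N. 2 * \<delta>)"
    using kh(2) by (intro sum_mono) (auto simp: D'_eq less_imp_le)
  also have "\<dots> = \<epsilon>"
    using assms by (simp add: \<delta>_def)
  finally have close: "expected_reward M X g (first_entry X N D) - \<epsilon> \<le> expected_reward M X g (first_entry X N D')"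
    by simp
  \<comment> \<open>The first entry time shows that the index set is non-empty, and
    \<open>opt\<close> bounds the rewards above, so the real supremum is a genuine one.\<close>
  have "(SUP \<tau>\<in>stopping_times M X N. expected_reward M X g \<tau>) \<le> expected_reward M X g (first_entry X N D)"
    using first_entry_stopping_time[of N D X M] D opt by (intro cSUP_least) auto
  with close have "(SUP \<tau>\<in>stopping_times M X N. expected_reward M X g \<tau>) - \<epsilon>
      \<le> expected_reward M X g (network_stopping_time N X I (\<lambda>_. m) \<theta>)"
    unfolding eq by simp
  moreover have "network_stopping_time N X I (\<lambda>_. m) \<theta> \<in> stopping_times M X N"
    unfolding eq using D' by (rule first_entry_stopping_time)
  ultimately show ?thesis
    using \<theta>(1) one by (intro exI[of _ "\<lambda>_. m"] conjI exI[of _ \<theta>]) (auto simp: m_def)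
qed

end
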